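(* Let $\mathcal{A}$ be a unital $C^*$-algebra, let $\phi:\mathcal{A}\to\mathbb{C}$ be a state, and let $x_1,\dots,x_n$ be self-adjoint elements of $\mathcal{A}$ with $\phi(x_j)=0$ for all $1\le j\le n$. Let $\mathrm{Cov}_\phi(\tilde{x})$ be the $n\times n$ matrix with $(i,j)$ entry $\mathrm{Re}\,\phi(x_ix_j)$, and let $\sigma(x_j)=\sqrt{\phi(x_j^2)}$. Then $$\frac14\prod_{k=1}^n\left[\sum_{i\ne k}|\phi([x_i,x_k])|^2\right]^{1/n}\le \|\mathrm{Cov}_\phi(\tilde{x})\|\left[\frac{\sum_{k=1}^n\sigma^2(x_k)}{n}\right]^{1/2}\left[\prod_{k=1}^n\sigma(x_k)\right]^{1/n},$$ where $\|\cdot\|$ is the operator norm on $M_n(\mathbb{C})$.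
   Context: A state is a positive linear functional $\phi$ with $\phi(1)=1$. The commutator is $[x,y]=xy-yx$. The matrix $\mathrm{Cov}_\phi(\tilde x)=\left(\mathrm{Re}\,\phi(x_ix_j)\right)_{i,j=1}^n$ is the covariance matrix of the $n$-tuple $\tilde{x}=(x_j)_{j=1}^n$, and $\sigma(x_j)$ is the standard deviation of $x_j$; $\sigma^2(x)$ means $\sigma(x)^2$. The operator norm is the one induced by the Euclidean norm on $\mathbb{C}^n$. *)

theory Defs
  imports "HOL-Analysis.Analysis"
begin

text \<open>
  Nontrivial unital complex C*-algebras. The distribution has no class of complex normed
  algebras, so the complex scalar multiplication, extending the real one, is added here.
  The requirements \<open>0 \<noteq> 1\<close> and \<open>norm 1 = 1\<close> inherited from \<^class>\<open>real_normed_algebra_1\<close> exclude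
  only the zero algebra, which carries no state: in a nonzero unital C*-algebra \<open>norm 1 = 1\<close>
  follows from the C*-identity.
\<close>

class unital_cstar_algebra = real_normed_algebra_1 + banach +
  fixes scaleC :: "complex \<Rightarrow> 'a \<Rightarrow> 'a" (infixr "*\<^sub>C" 75)
    and adj :: "'a \<Rightarrow> 'a"
  assumes scaleC_of_real: "complex_of_real r *\<^sub>C x = r *\<^sub>R x"
    and scaleC_add_right: "a *\<^sub>C (x + y) = a *\<^sub>C x + a *\<^sub>C y"
    and scaleC_add_left: "(a + b) *\<^sub>C x = a *\<^sub>C x + b *\<^sub>C x"
    and scaleC_scaleC: "a *\<^sub>C (b *\<^sub>C x) = (a * b) *\<^sub>C x"
    and mult_scaleC_left: "(a *\<^sub>C x) * y = a *\<^sub>C (x * y)"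
    and mult_scaleC_right: "x * (a *\<^sub>C y) = a *\<^sub>C (x * y)"
    and norm_scaleC: "norm (a *\<^sub>C x) = cmod a * norm x"
    and adj_adj: "adj (adj x) = x"
    and adj_add: "adj (x + y) = adj x + adj y"
    and adj_scaleC: "adj (a *\<^sub>C x) = cnj a *\<^sub>C adj x"
    and adj_mult: "adj (x * y) = adj y * adj x"
    and cstar_identity: "norm (adj x * x) = (norm x)\<^sup>2"

lemma vector_space_scaleC:
  "vector_space (scaleC :: complex \<Rightarrow> 'a \<Rightarrow> 'a::unital_cstar_algebra)"
proof
  show "1 *\<^sub>C x = x" for x :: 'a
    using scaleC_of_real[of 1 x] by simp
qed (simp_all add: scaleC_add_right scaleC_add_left scaleC_scaleC)

instantiation complex :: unital_cstar_algebra
begin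

definition scaleC_complex :: "complex \<Rightarrow> complex \<Rightarrow> complex"
  where "scaleC_complex = (*)"

definition adj_complex :: "complex \<Rightarrow> complex"
  where "adj_complex = cnj"

instance
  by standard
    (simp_all add: scaleC_complex_def adj_complex_def scaleR_conv_of_real norm_mult
      power2_eq_square algebra_simps)

end

definition self_adjoint :: "'a::unital_cstar_algebra \<Rightarrow> bool"
  where "self_adjoint x \<longleftrightarrow> adj x = x"

definition positive_functional :: "('a::unital_cstar_algebra \<Rightarrow> complex) \<Rightarrow> bool"
  where "positive_functional \<phi> \<longleftrightarrow>
    Vector_Spaces.linear scaleC (*) \<phi> \<and> (\<forall>x. \<phi> (adj x * x) \<in> \<real>\<^sub>\<ge>\<^sub>0)"

definition state :: "('a::unital_cstar_algebra \<Rightarrow> complex) \<Rightarrow> bool"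
  where "state \<phi> \<longleftrightarrow> positive_functional \<phi> \<and> \<phi> 1 = 1"

definition commutator :: "'a::ring \<Rightarrow> 'a \<Rightarrow> 'a"
  where "commutator x y = x * y - y * x"

definition covariance_matrix ::
    "('a::unital_cstar_algebra \<Rightarrow> complex) \<Rightarrow> ('n \<Rightarrow> 'a) \<Rightarrow> complex ^ 'n ^ 'n"
  where "covariance_matrix \<phi> x = (\<chi> i j. complex_of_real (Re (\<phi> (x i * x j))))"

text \<open>
  The standard deviation of a self-adjoint \<open>x\<close> with \<open>\<phi> x = 0\<close>; then \<open>\<phi> (x\<^sup>2)\<close> is a nonnegative
  real number, so nothing is lost by taking its real part.
\<close>

definition std_dev :: "('a::unital_cstar_algebra \<Rightarrow> complex) \<Rightarrow> 'a \<Rightarrow> real"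
  where "std_dev \<phi> x = sqrt (Re (\<phi> (x\<^sup>2)))"

text \<open>The norm on \<^typ>\<open>complex ^ 'n\<close> is the Euclidean one.\<close>

definition op_norm :: "complex ^ 'n ^ 'n \<Rightarrow> real"
  where "op_norm A = onorm (\<lambda>v. A *v v)"

end

theory Submission
  imports Defs
begin

text \<open>
  Write \<open>S\<close> for the covariance matrix, so that \<open>S\<^sub>k\<^sub>k = \<sigma>(x\<^sub>k)\<^sup>2\<close>. The heart of the matter is the
  bound \<open>\<Sum>\<^sub>i \<bar>\<phi> [x\<^sub>i, x\<^sub>k]\<bar>\<^sup>2 \<le> 4 \<parallel>S\<parallel> \<sigma>(x\<^sub>k)\<^sup>2\<close> for each single \<open>k\<close> (\<open>sum_commutators_le\<close>).
  Positivity of \<open>\<phi>\<close> makes each \<open>\<phi> [x\<^sub>i, x\<^sub>k]\<close> a purely imaginary number \<open>\<i> d\<^sub>i\<close>. Robertson's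
  uncertainty relation \<open>\<bar>\<phi> [y, x\<^sub>k]\<bar>\<^sup>2 \<le> 4 \<phi> (y\<^sup>2) \<phi> (x\<^sub>k\<^sup>2)\<close> (\<open>robertson_uncertainty\<close>) is
  applied, not to the \<open>x\<^sub>i\<close> one at a time, but to the single observable \<open>y = \<Sum>\<^sub>i d\<^sub>i x\<^sub>i\<close>, which
  is aligned with the commutators: then \<open>\<phi> [y, x\<^sub>k] = \<i> \<bar>d\<bar>\<^sup>2\<close>, whereas \<open>\<phi> (y\<^sup>2)\<close> is the value at \<open>d\<close> of the quadratic form of \<open>S\<close> and so
  is at most \<open>\<parallel>S\<parallel> \<bar>d\<bar>\<^sup>2\<close> (\<open>quadratic_form_le_op_norm\<close>). Cancelling one factor \<open>\<bar>d\<bar>\<^sup>2\<close> gives the bound.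

  The geometric mean over \<open>k\<close> of these bounds is at most
  \<open>4 \<parallel>S\<parallel> (\<Prod>\<^sub>k \<sigma>(x\<^sub>k))\<^sup>2\<^sup>/\<^sup>n\<close>, and by the inequality of arithmetic and geometric means one of the two
  factors \<open>(\<Prod>\<^sub>k \<sigma>(x\<^sub>k))\<^sup>1\<^sup>/\<^sup>n\<close> is at most the root mean square of the \<open>\<sigma>(x\<^sub>k)\<close>.
\<close>

section \<open>The involution and positive functionals\<close>

lemma adj_scaleR: "adj (r *\<^sub>R x) = r *\<^sub>R adj (x :: 'a::unital_cstar_algebra)"
  by (metis adj_scaleC complex_cnj_complex_of_real scaleC_of_real)

lemma adj_0 [simp]: "adj (0 :: 'a::unital_cstar_algebra) = 0"
  using adj_add[of 0 "0 :: 'a"] by simp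

lemma adj_sum: "adj (\<Sum>i\<in>A. f i) = (\<Sum>i\<in>A. adj (f i :: 'a::unital_cstar_algebra))"
  by (induction A rule: infinite_finite_induct) (simp_all add: adj_add)

lemma self_adjoint_sum_scaleR:
  assumes "\<And>i. i \<in> A \<Longrightarrow> self_adjoint (f i)"
  shows "self_adjoint (\<Sum>i\<in>A. a i *\<^sub>R f i)"
  using assms by (simp add: self_adjoint_def adj_sum adj_scaleR)

context
  fixes \<phi> :: "'a::unital_cstar_algebra \<Rightarrow> complex"
  assumes pos: "positive_functional \<phi>"
begin

lemma functional_add: "\<phi> (x + y) = \<phi> x + \<phi> y"
  using pos by (simp add: positive_functional_def Vector_Spaces.linear_def module_hom_iff)

lemma functional_scaleC: "\<phi> (c *\<^sub>C x) = c * \<phi> x"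
  using pos by (simp add: positive_functional_def Vector_Spaces.linear_def module_hom_iff)

lemma functional_scaleR: "\<phi> (r *\<^sub>R x) = of_real r * \<phi> x"
  by (simp flip: scaleC_of_real add: functional_scaleC)

lemma functional_0: "\<phi> 0 = 0"
  using functional_add[of 0 0] by simp

lemma functional_diff: "\<phi> (x - y) = \<phi> x - \<phi> y"
  using functional_add[of "x - y" y] by simp

lemma functional_sum: "\<phi> (\<Sum>i\<in>A. f i) = (\<Sum>i\<in>A. \<phi> (f i))"
  by (induction A rule: infinite_finite_induct) (simp_all add: functional_0 functional_add)

lemma functional_nonneg: "\<phi> (adj x * x) \<in> \<real>\<^sub>\<ge>\<^sub>0"
  using pos by (simp add: positive_functional_def)

lemma functional_square_nonneg: "self_adjoint x \<Longrightarrow> \<phi> (x * x) \<in> \<real>\<^sub>\<ge>\<^sub>0"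
  using functional_nonneg[of x] by (simp add: self_adjoint_def)

section \<open>Robertson's uncertainty relation\<close>

text \<open>
  For self-adjoint \<open>x\<close>, \<open>y\<close> and real \<open>t\<close>, this is the positivity of \<open>\<phi>\<close> at \<open>y + \<i> t x\<close>.
\<close>

lemma functional_commutator_pencil:
  assumes "self_adjoint x" "self_adjoint y"
  shows "\<phi> (y * y) + \<i> * of_real t * \<phi> (commutator y x) + of_real (t\<^sup>2) * \<phi> (x * x) \<in> \<real>\<^sub>\<ge>\<^sub>0"
proof -
  let ?c = "\<i> * complex_of_real t"
  have "adj (y + ?c *\<^sub>C x) * (y + ?c *\<^sub>C x) = (y + (- ?c) *\<^sub>C x) * (y + ?c *\<^sub>C x)"
    using assms by (simp add: self_adjoint_def adj_add adj_scaleC)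
  also have "\<dots> = y * y + ?c *\<^sub>C (y * x) + (- ?c) *\<^sub>C (x * y) + (- ?c * ?c) *\<^sub>C (x * x)"
    by (simp add: distrib_left distrib_right mult_scaleC_left mult_scaleC_right scaleC_scaleC
        scaleC_add_right add.assoc)
  finally have "\<phi> (adj (y + ?c *\<^sub>C x) * (y + ?c *\<^sub>C x))
      = \<phi> (y * y) + ?c * \<phi> (commutator y x) + of_real (t\<^sup>2) * \<phi> (x * x)"
    by (simp add: functional_add functional_scaleC functional_diff commutator_def algebra_simps
        power2_eq_square)
  with functional_nonneg show ?thesis by metis
qed

lemma functional_commutator_imaginary:
  assumes "self_adjoint x" "self_adjoint y"
  shows "Re (\<phi> (commutator y x)) = 0"
  using functional_commutator_pencil[OF assms, of 1] functional_square_nonneg assms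
  by (simp add: complex_nonneg_Reals_iff)

lemma robertson_uncertainty:
  assumes "self_adjoint x" "self_adjoint y"
  shows "(Im (\<phi> (commutator y x)))\<^sup>2 \<le> 4 * Re (\<phi> (y * y)) * Re (\<phi> (x * x))"
proof -
  define p q d where "p = Re (\<phi> (x * x))" and "q = Re (\<phi> (y * y))"
    and "d = Im (\<phi> (commutator y x))"
  have quadratic: "0 \<le> q - t * d + t\<^sup>2 * p" for t
    using functional_commutator_pencil[OF assms, of t]
    by (simp add: complex_nonneg_Reals_iff p_def q_def d_def)
  have "p \<ge> 0"
    using functional_square_nonneg[OF assms(1)] by (simp add: complex_nonneg_Reals_iff p_def)
  have "d\<^sup>2 \<le> 4 * q * p"
  proof (cases "p = 0")
    case True
    \<comment> \<open>Here the polynomial in \<open>t\<close> is linear, so it must be constant.\<close>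
    have "d = 0"
      using True quadratic[of "(q + 1) / d"] by (cases "d = 0") auto
    then show ?thesis using True by simp
  next
    case False
    \<comment> \<open>The quadratic polynomial is evaluated at its minimum.\<close>
    then show ?thesis
      using quadratic[of "d / (2 * p)"] \<open>p \<ge> 0\<close> by (simp add: field_simps power2_eq_square)
  qed
  then show ?thesis by (simp add: p_def q_def d_def)
qed

end

section \<open>The operator norm bounds the quadratic form\<close>

lemma bounded_linear_matrix_vector_mult:
  "bounded_linear ((*v) (A :: complex ^ 'n ^ 'm))"
proof -
  have "linear ((*v) A)"
    by (rule linearI)
      (simp_all add: vec_eq_iff matrix_vector_mult_def scaleR_sum_right distrib_left
        sum.distrib)
  then show ?thesis by (simp add: linear_conv_bounded_linear)
qed

lemma quadratic_form_le_op_norm: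
  fixes A :: "complex ^ 'n ^ 'n" and a :: "'n \<Rightarrow> real"
  shows "(\<Sum>i\<in>UNIV. \<Sum>j\<in>UNIV. a i * a j * Re (A $ i $ j)) \<le> op_norm A * (\<Sum>i\<in>UNIV. (a i)\<^sup>2)"
proof -
  define v :: "complex ^ 'n" where "v = (\<chi> i. of_real (a i))"
  have "(\<Sum>i\<in>UNIV. \<Sum>j\<in>UNIV. a i * a j * Re (A $ i $ j)) = v \<bullet> (A *v v)"
    by (simp add: inner_vec_def v_def matrix_vector_mult_def inner_complex_def sum_distrib_left
        mult_ac)
  also have "\<dots> \<le> norm v * norm (A *v v)"
    by (rule norm_cauchy_schwarz)
  also have "\<dots> \<le> norm v * (op_norm A * norm v)"
    unfolding op_norm_def
    by (intro mult_left_mono onorm bounded_linear_matrix_vector_mult) simp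
  also have "\<dots> = op_norm A * (v \<bullet> v)"
    by (simp add: power2_norm_eq_inner flip: power2_eq_square)
  also have "v \<bullet> v = (\<Sum>i\<in>UNIV. (a i)\<^sup>2)"
    by (simp add: inner_vec_def v_def inner_complex_def power2_eq_square)
  finally show ?thesis .
qed

lemma op_norm_nonneg: "op_norm A \<ge> 0"
  unfolding op_norm_def by (intro onorm_pos_le bounded_linear_matrix_vector_mult)

section \<open>The bound for one observable\<close>

lemma Re_functional_square_linear_combination:
  fixes x :: "'n::finite \<Rightarrow> 'a::unital_cstar_algebra"
  assumes "positive_functional \<phi>"
  shows "Re (\<phi> ((\<Sum>i\<in>UNIV. a i *\<^sub>R x i) * (\<Sum>i\<in>UNIV. a i *\<^sub>R x i)))
    = (\<Sum>i\<in>UNIV. \<Sum>j\<in>UNIV. a i * a j * Re (covariance_matrix \<phi> x $ i $ j))"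
  by (simp add: sum_product functional_sum[OF assms] functional_scaleR[OF assms]
      covariance_matrix_def mult_ac)

text \<open>
  Robertson's relation for \<open>x k\<close> and the combination of the \<open>x i\<close> whose coefficients are the
  commutators themselves; both sides then contain the sum on the left, which is cancelled.
\<close>

lemma sum_commutators_le:
  fixes x :: "'n::finite \<Rightarrow> 'a::unital_cstar_algebra"
  assumes pos: "positive_functional \<phi>" and sa: "\<And>j. self_adjoint (x j)"
  shows "(\<Sum>i\<in>UNIV - {k}. (cmod (\<phi> (commutator (x i) (x k))))\<^sup>2)
    \<le> 4 * op_norm (covariance_matrix \<phi> x) * (std_dev \<phi> (x k))\<^sup>2"
proof -
  let ?S = "covariance_matrix \<phi> x"
  define d where "d i = Im (\<phi> (commutator (x i) (x k)))" for i
  define y where "y = (\<Sum>i\<in>UNIV. d i *\<^sub>R x i)"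
  define D where "D = (\<Sum>i\<in>UNIV. (d i)\<^sup>2)"
  define p where "p = Re (\<phi> (x k * x k))"
  have "p \<ge> 0"
    using functional_square_nonneg[OF pos sa[of k]] by (simp add: complex_nonneg_Reals_iff p_def)
  then have variance: "(std_dev \<phi> (x k))\<^sup>2 = p"
    by (simp add: std_dev_def p_def power2_eq_square)
  have "(cmod (\<phi> (commutator (x i) (x k))))\<^sup>2 = (d i)\<^sup>2" for i
    using functional_commutator_imaginary[OF pos sa[of k] sa[of i]] by (simp add: cmod_power2 d_def)
  \<comment> \<open>The term for \<open>i = k\<close> vanishes, so it may be included.\<close>
  moreover have "d k = 0"
    by (simp add: d_def commutator_def functional_0[OF pos])
  ultimately have sum_eq: "(\<Sum>i\<in>UNIV - {k}. (cmod (\<phi> (commutator (x i) (x k))))\<^sup>2) = D"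
    unfolding D_def by (auto intro!: sum.mono_neutral_cong_left)
  have "commutator y (x k) = (\<Sum>i\<in>UNIV. d i *\<^sub>R commutator (x i) (x k))"
    by (simp add: commutator_def y_def sum_distrib_left sum_distrib_right sum_subtractf
        scaleR_diff_right)
  then have "Im (\<phi> (commutator y (x k))) = D"
    by (simp add: functional_sum[OF pos] functional_scaleR[OF pos] D_def power2_eq_square
        flip: d_def)
  moreover have "self_adjoint y"
    unfolding y_def by (rule self_adjoint_sum_scaleR) (rule sa)
  ultimately have "D\<^sup>2 \<le> 4 * Re (\<phi> (y * y)) * p"
    using robertson_uncertainty[OF pos sa[of k]] by (metis p_def)
  also have "\<dots> \<le> 4 * (op_norm ?S * D) * p"
    using quadratic_form_le_op_norm[of d ?S] \<open>p \<ge> 0\<close>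
    unfolding y_def Re_functional_square_linear_combination[OF pos] D_def
    by (intro mult_right_mono mult_left_mono) auto
  finally have "D * D \<le> (4 * op_norm ?S * p) * D"
    by (simp add: power2_eq_square mult_ac)
  moreover have "D \<ge> 0" by (simp add: D_def sum_nonneg)
  moreover have "4 * op_norm ?S * p \<ge> 0" by (simp add: \<open>p \<ge> 0\<close> op_norm_nonneg)
  ultimately have "D \<le> 4 * op_norm ?S * p"
    by (cases "D = 0") auto
  then show ?thesis by (simp add: sum_eq variance)
qed

section \<open>Geometric means\<close>

text \<open>This is the inequality of arithmetic and geometric means for the squares.\<close>

lemma geometric_mean_le_quadratic_mean:
  fixes s :: "'n::finite \<Rightarrow> real"
  assumes "\<And>k. s k \<ge> 0"
  shows "(\<Prod>k\<in>UNIV. s k) powr (1 / real CARD('n))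
    \<le> ((\<Sum>k\<in>UNIV. (s k)\<^sup>2) / real CARD('n)) powr (1 / 2)"
proof -
  let ?n = "real CARD('n)"
  have "(\<Prod>k\<in>UNIV. s k) powr (1 / ?n) = ((\<Prod>k\<in>UNIV. (s k)\<^sup>2) powr (1 / ?n)) powr (1 / 2)"
    using assms prod_nonneg[of UNIV s]
    by (simp add: powr_half_sqrt power2_eq_square powr_mult prod.distrib)
  also have "\<dots> \<le> ((\<Sum>k\<in>UNIV. (s k)\<^sup>2) / ?n) powr (1 / 2)"
    using arith_geom_mean[of UNIV "\<lambda>k. (s k)\<^sup>2"]
    by (intro powr_mono2) (simp_all add: prod_nonneg flip: sum_divide_distrib)
  finally show ?thesis .
qed

theorem theorem3:
  fixes \<phi> :: "'a::unital_cstar_algebra \<Rightarrow> complex"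
    and x :: "'n::finite \<Rightarrow> 'a"
  assumes "state \<phi>"
    and "\<And>j. self_adjoint (x j)"
    and "\<And>j. \<phi> (x j) = 0"
  shows "1 / 4 * (\<Prod>k\<in>UNIV. (\<Sum>i\<in>UNIV - {k}. (cmod (\<phi> (commutator (x i) (x k))))\<^sup>2)
             powr (1 / real CARD('n)))
    \<le> op_norm (covariance_matrix \<phi> x)
      * ((\<Sum>k\<in>UNIV. (std_dev \<phi> (x k))\<^sup>2) / real CARD('n)) powr (1 / 2)
      * (\<Prod>k\<in>UNIV. std_dev \<phi> (x k)) powr (1 / real CARD('n))"
proof -
  let ?n = "real CARD('n)"
  let ?N = "op_norm (covariance_matrix \<phi> x)"
  have pos: "positive_functional \<phi>" using assms(1) by (simp add: state_def)
  have sd: "std_dev \<phi> (x k) \<ge> 0" for k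
    using functional_square_nonneg[OF pos assms(2)]
    by (simp add: std_dev_def power2_eq_square complex_nonneg_Reals_iff)
  define P where "P = (\<Prod>k\<in>UNIV. std_dev \<phi> (x k))"
  have "P \<ge> 0" unfolding P_def by (intro prod_nonneg) (simp add: sd)
  have "(\<Prod>k\<in>UNIV. (\<Sum>i\<in>UNIV - {k}. (cmod (\<phi> (commutator (x i) (x k))))\<^sup>2) powr (1 / ?n))
      \<le> (\<Prod>k\<in>UNIV. (4 * ?N * (std_dev \<phi> (x k))\<^sup>2) powr (1 / ?n))"
    by (intro prod_mono conjI powr_mono2 sum_commutators_le pos assms(2)) (auto intro: sum_nonneg)
  also have "\<dots> = ((4 * ?N) ^ CARD('n) * P\<^sup>2) powr (1 / ?n)"
    using op_norm_nonneg[of "covariance_matrix \<phi> x"]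
    by (simp add: prod.distrib P_def prod_power_distrib flip: prod_powr_distrib)
  also have "\<dots> = 4 * ?N * (P powr (1 / ?n) * P powr (1 / ?n))"
    using op_norm_nonneg[of "covariance_matrix \<phi> x"] \<open>P \<ge> 0\<close>
    by (simp add: powr_mult power2_eq_square real_root_power_cancel
        flip: root_powr_inverse)
  finally have "1 / 4 * (\<Prod>k\<in>UNIV. (\<Sum>i\<in>UNIV - {k}. (cmod (\<phi> (commutator (x i) (x k))))\<^sup>2)
      powr (1 / ?n)) \<le> ?N * P powr (1 / ?n) * P powr (1 / ?n)"
    by simp
  also have "\<dots> \<le> ?N * ((\<Sum>k\<in>UNIV. (std_dev \<phi> (x k))\<^sup>2) / ?n) powr (1 / 2) * P powr (1 / ?n)"
    unfolding P_def
    by (intro mult_right_mono mult_left_mono geometric_mean_le_quadratic_mean sd op_norm_nonneg)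
      simp
  finally show ?thesis unfolding P_def .
qed

end
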